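(* Let $n\ge 1$ and $s\ge 2$ be integers, let $Z=\{z_1,\dots,z_s\}\subset B_2^n\subset\mathbb{R}^n$ consist of $s$ distinct points, and let $N\ge s-1$ be an integer. Then there exists a matrix $V_N(Z)^+\in\mathbb{R}^{\nu\times s}$ (a right inverse, not necessarily the Moore–Penrose inverse) such that $$V_N(Z)\cdot V_N(Z)^+=I_s,$$ where $I_s$ is the $s\times s$ identity matrix, and moreover $$\|V_N(Z)^+\|\le s^{3/2}\sqrt{\nu}\left(\frac{4n}{\kappa(Z)}\right)^{s-1}.$$
   Context: $B_2^n=\{x\in\mathbb{R}^n:\|x\|_2\le 1\}$. $\nu=\nu(n,N)=\binom{N+n}{N}$ is the number of monomials $z^\alpha=\prod_\ell z_\ell^{\alpha_\ell}$ in $n$ variables with $\alpha\in\mathbb{Z}_{\ge0}^n$, $|\alpha|=\sum_\ell\alpha_\ell\le N$. $V_N(Z)\in\mathbb{R}^{s\times\nu}$ is the matrix whose $i$-th row is $V_N(z_i)=(z_i^\alpha)_{|\alpha|\le N}$ (in a fixed ordering of the multi-indices, with $0^0=1$). $\|B\|=\sup_{\|y\|_2=1}\|By\|_2$ is the Euclidean operator norm. The projection separations are $\rho(Z,j)=\max_{\|v\|_2=1}\min_{i\ne j}|\langle v,z_j-z_i\rangle|$ (maximum over $v\in\mathbb{R}^n$) and $\kappa(Z)=\min_{1\le j\le s}\rho(Z,j)$; these are positive since the points are distinct. *)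

theory Defs
  imports "HOL-Analysis.Analysis"
begin

definition multi_indices :: "nat \<Rightarrow> ('n::finite \<Rightarrow> nat) set" where
  "multi_indices N = {\<alpha>. (\<Sum>l\<in>UNIV. \<alpha> l) \<le> N}"

definition nu :: "nat \<Rightarrow> nat \<Rightarrow> nat" where
  "nu n N = (N + n) choose N"

lemma card_multi_indices:
  "card (multi_indices N :: ('n::finite \<Rightarrow> nat) set) = nu CARD('n) N"
proof -
  let ?A = "multi_indices N :: ('n \<Rightarrow> nat) set"
  let ?B = "{l::nat list. length l = Suc CARD('n) \<and> sum_list l = N}"
  obtain xs :: "'n list" where xs: "set xs = UNIV" "distinct xs"
    using finite_distinct_list[of "UNIV :: 'n set"] by auto
  have len: "length xs = CARD('n)"
    using xs distinct_card[of xs] by simp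
  have sm: "sum_list (map \<alpha> xs) = (\<Sum>l\<in>UNIV. \<alpha> l)" for \<alpha> :: "'n \<Rightarrow> nat"
    using xs by (simp add: sum_list_distinct_conv_sum_set)
  let ?f = "\<lambda>\<alpha>. (N - (\<Sum>l\<in>UNIV. \<alpha> l)) # map \<alpha> xs"
  let ?g = "\<lambda>l x. the (map_of (zip xs (tl l)) x)"
  have gf: "?g (?f \<alpha>) = \<alpha>" for \<alpha> :: "'n \<Rightarrow> nat"
    using xs by (auto simp: map_of_zip_map)
  have mg: "map (?g l) xs = tl l" if "l \<in> ?B" for l
  proof (rule nth_equalityI)
    show "length (map (?g l) xs) = length (tl l)"
      using that len by simp
    fix i assume "i < length (map (?g l) xs)"
    then show "map (?g l) xs ! i = tl l ! i"
      using that len xs by (simp add: map_of_zip_nth)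
  qed
  have "bij_betw ?f ?A ?B"
  proof (rule bij_betw_byWitness[where f' = ?g])
    show "\<forall>\<alpha>\<in>?A. ?g (?f \<alpha>) = \<alpha>" using gf by blast
    show "?f ` ?A \<subseteq> ?B" by (auto simp: multi_indices_def len sm)
    have *: "(\<Sum>x\<in>UNIV. ?g l x) = sum_list (tl l)" if "l \<in> ?B" for l
      using mg[OF that] sm[of "?g l"] by simp
    have **: "hd l + sum_list (tl l) = N" if "l \<in> ?B" for l
      using that by (cases l) auto
    show "\<forall>l\<in>?B. ?f (?g l) = l"
    proof
      fix l assume l: "l \<in> ?B"
      then have "?f (?g l) = hd l # tl l"
        using *[OF l] **[OF l] mg[OF l] by simp
      moreover have "l \<noteq> []" using l by auto
      ultimately show "?f (?g l) = l" by simp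
    qed
    show "?g ` ?B \<subseteq> ?A"
    proof
      fix a assume "a \<in> ?g ` ?B"
      then obtain l where l: "l \<in> ?B" "a = ?g l" by blast
      have "sum_list (tl l) \<le> N" using **[OF l(1)] by linarith
      then show "a \<in> ?A"
        using *[OF l(1)] l(2) by (simp add: multi_indices_def)
    qed
  qed
  then have "card ?A = card ?B" by (rule bij_betw_same_card)
  also have "\<dots> = (N + Suc CARD('n) - 1) choose N"
    by (rule card_length_sum_list)
  finally show ?thesis by (simp add: nu_def)
qed

definition monomial :: "real^'n \<Rightarrow> ('n::finite \<Rightarrow> nat) \<Rightarrow> real" where
  "monomial x \<alpha> = (\<Prod>l\<in>UNIV. x $ l ^ \<alpha> l)"

text \<open>The matrix \<open>V\<^sub>N(Z)\<close>: row \<open>i\<close> is \<open>(z\<^sub>i\<^sup>\<alpha>)\<close>. Its columns are indexed by a finite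
  type \<open>'m\<close>, and \<open>e\<close> plays the role of the ordering of the multi-indices: it is meant to be a
  bijection from \<open>'m\<close> onto \<^term>\<open>multi_indices N\<close>, which forces \<open>CARD('m)\<close> to be
  \<^term>\<open>nu CARD('n) N\<close>.\<close>

definition monomial_matrix ::
    "('m \<Rightarrow> 'n \<Rightarrow> nat) \<Rightarrow> ('s \<Rightarrow> real^'n) \<Rightarrow> real^('m::finite)^('s::finite)" where
  "monomial_matrix e z = (\<chi> i k. monomial (z i) (e k))"

text \<open>The supremum is an attained maximum when the index type has at least two
  elements; with only one, \<^const>\<open>Min\<close> would be taken over the empty set.\<close>

definition rho :: "('s::finite \<Rightarrow> real^'n) \<Rightarrow> 's \<Rightarrow> real" where
  "rho z j = (SUP v\<in>sphere 0 1. MIN i\<in>UNIV - {j}. \<bar>v \<bullet> (z j - z i)\<bar>)"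

definition kappa :: "('s::finite \<Rightarrow> real^'n) \<Rightarrow> real" where
  "kappa z = (MIN j. rho z j)"

end

theory Submission
  imports Defs
begin

text \<open>For each \<open>j\<close> choose a unit vector \<open>v\<close> with \<open>\<bar>v \<bullet> (z j - z i)\<bar> > rho z j / 2\<close> for all
  \<open>i \<noteq> j\<close>. The product over \<open>i \<noteq> j\<close> of the affine functions
  \<open>(v \<bullet> x - v \<bullet> z i) / (v \<bullet> (z j - z i))\<close> is a Lagrange polynomial of degree \<open>s - 1\<close>, and its
  coefficients form the \<open>j\<close>-th column of the right inverse. The \<open>\<ell>\<^sup>1\<close> norm of the coefficients is
  submultiplicative, and each factor has norm at most \<open>(n + 1) / (kappa z / 2) \<le> 4 n / kappa z\<close>.\<close>

section \<open>Polynomials with bounded coefficient norm\<close>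

text \<open>\<open>poly_l1 d B f\<close>: the function \<open>f\<close> is given by a polynomial of degree at most \<open>d\<close>
  whose coefficients have \<open>\<ell>\<^sup>1\<close> norm at most \<open>B\<close>.\<close>

inductive poly_l1 :: "nat \<Rightarrow> real \<Rightarrow> (real^'n \<Rightarrow> real) \<Rightarrow> bool" for d where
  monomial: "\<alpha> \<in> multi_indices d \<Longrightarrow> poly_l1 d 1 (\<lambda>x. monomial x \<alpha>)"
| scale: "poly_l1 d B f \<Longrightarrow> poly_l1 d (\<bar>c\<bar> * B) (\<lambda>x. c * f x)"
| add: "poly_l1 d B f \<Longrightarrow> poly_l1 d C g \<Longrightarrow> poly_l1 d (B + C) (\<lambda>x. f x + g x)"

lemma poly_l1_one: "poly_l1 d 1 (\<lambda>x::real^'n. 1)"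
  using poly_l1.monomial[of "\<lambda>_::'n. 0" d] by (simp add: multi_indices_def monomial_def)

lemma poly_l1_zero: "poly_l1 d 0 (\<lambda>x::real^'n. 0)"
  using poly_l1.scale[OF poly_l1_one, of d 0] by simp

lemma poly_l1_sum:
  assumes "finite A" "\<And>i. i \<in> A \<Longrightarrow> poly_l1 d (B i) (f i)"
  shows "poly_l1 d (\<Sum>i\<in>A. B i) (\<lambda>x::real^'n. \<Sum>i\<in>A. f i x)"
  using assms
proof (induction A rule: finite_induct)
  case empty
  show ?case by (simp add: poly_l1_zero)
next
  case (insert i A)
  then show ?case using poly_l1.add[of d "B i" "f i" "\<Sum>i\<in>A. B i"] by simp
qed

lemma poly_l1_Suc: "poly_l1 d B f \<Longrightarrow> poly_l1 (Suc d) B f"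
  by (induction rule: poly_l1.induct)
    (auto intro: poly_l1.intros simp: multi_indices_def)

lemma poly_l1_mono:
  assumes "poly_l1 d B f" "d \<le> d'"
  shows "poly_l1 d' B f"
  using assms(2,1) by (induction rule: dec_induct) (auto intro: poly_l1_Suc)

text \<open>Multiplication by a coordinate only shifts one exponent: monomials go to monomials, so
  no coefficient changes and \<open>B\<close> survives.\<close>

lemma poly_l1_mult_coordinate:
  assumes "poly_l1 d B f"
  shows "poly_l1 (Suc d) B (\<lambda>x. x $ l * f x)"
  using assms
proof (induction rule: poly_l1.induct)
  case (monomial \<alpha>)
  let ?\<beta> = "\<lambda>k. \<alpha> k + (if k = l then 1 else 0)"
  have "?\<beta> \<in> multi_indices (Suc d)"
    using monomial by (simp add: multi_indices_def sum.distrib)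
  moreover have "monomial x ?\<beta> = x $ l * monomial x \<alpha>" for x
  proof -
    have "(\<Prod>k\<in>UNIV. x $ k ^ (if k = l then 1 else 0)) = (\<Prod>k\<in>UNIV. if k = l then x $ l else 1)"
      by (rule prod.cong) auto
    then show ?thesis
      by (simp add: monomial_def power_add prod.distrib)
  qed
  ultimately show ?case using poly_l1.monomial[of ?\<beta> "Suc d"] by simp
next
  case (scale B f c)
  then show ?case using poly_l1.scale[OF scale.IH, of c] by (simp add: mult.left_commute)
next
  case (add B f C g)
  then show ?case using poly_l1.add[OF add.IH] by (simp add: distrib_left)
qed

text \<open>Expand the affine factor into its coordinate terms and its constant. Each term
  multiplies the norm of \<open>f\<close> by the absolute value of its own coefficient, and these
  costs add up.\<close>

lemma poly_l1_mult_affine: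
  fixes v :: "real^'n"
  assumes "poly_l1 d B f"
  shows "poly_l1 (Suc d) (((\<Sum>l\<in>UNIV. \<bar>v $ l\<bar>) + \<bar>a\<bar>) * B) (\<lambda>x. (v \<bullet> x + a) * f x)"
proof -
  have "poly_l1 (Suc d) (\<Sum>l\<in>UNIV. \<bar>v $ l\<bar> * B) (\<lambda>x. \<Sum>l\<in>UNIV. v $ l * (x $ l * f x))"
    by (intro poly_l1_sum poly_l1.scale poly_l1_mult_coordinate assms) simp
  moreover have "poly_l1 (Suc d) (\<bar>a\<bar> * B) (\<lambda>x. a * f x)"
    by (intro poly_l1.scale poly_l1_Suc assms)
  ultimately have "poly_l1 (Suc d) ((\<Sum>l\<in>UNIV. \<bar>v $ l\<bar> * B) + \<bar>a\<bar> * B)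
      (\<lambda>x. (\<Sum>l\<in>UNIV. v $ l * (x $ l * f x)) + a * f x)"
    by (rule poly_l1.add)
  then show ?thesis
    by (simp add: inner_vec_def sum_distrib_right distrib_right mult.assoc)
qed

lemma poly_l1_prod_affine:
  fixes v :: "'i \<Rightarrow> real^'n"
  assumes "finite A"
  shows "poly_l1 (card A) (\<Prod>i\<in>A. (\<Sum>l\<in>UNIV. \<bar>v i $ l\<bar>) + \<bar>a i\<bar>) (\<lambda>x. \<Prod>i\<in>A. v i \<bullet> x + a i)"
  using assms
proof (induction A rule: finite_induct)
  case empty
  show ?case by (simp add: poly_l1_one)
next
  case (insert i A)
  then show ?case using poly_l1_mult_affine[OF insert.IH, of "v i" "a i"] by simp
qed

text \<open>Turns the inductive bookkeeping into a coefficient vector indexed like the columns of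
  \<open>monomial_matrix e z\<close>. The norm is only bounded by \<open>B\<close>, since
  coefficients may cancel in a sum.\<close>

lemma poly_l1_coefficients:
  fixes e :: "'m::finite \<Rightarrow> 'n::finite \<Rightarrow> nat"
  assumes "poly_l1 d B f" and e: "bij_betw e UNIV (multi_indices d)"
  shows "\<exists>c::real^'m. (\<forall>x. f x = (\<Sum>k\<in>UNIV. monomial x (e k) * c $ k)) \<and> (\<Sum>k\<in>UNIV. \<bar>c $ k\<bar>) \<le> B"
  using assms(1)
proof (induction rule: poly_l1.induct)
  case (monomial \<alpha>)
  then obtain k where k: "e k = \<alpha>"
    using e by (metis bij_betw_imp_surj_on imageE)
  have "(\<Sum>k'\<in>UNIV. \<bar>axis k (1::real) $ k'\<bar>) = (\<Sum>k'\<in>UNIV. if k' = k then 1 else 0)"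
    by (rule sum.cong) (auto simp: axis_def)
  moreover have "(\<Sum>k'\<in>UNIV. monomial x (e k') * axis k (1::real) $ k')
      = (\<Sum>k'\<in>UNIV. if k' = k then monomial x \<alpha> else 0)" for x
    by (rule sum.cong) (auto simp: axis_def k)
  ultimately show ?case by (intro exI[of _ "axis k 1"]) simp
next
  case (scale B f a)
  then obtain c :: "real^'m" where c: "\<And>x. f x = (\<Sum>k\<in>UNIV. monomial x (e k) * c $ k)"
    "(\<Sum>k\<in>UNIV. \<bar>c $ k\<bar>) \<le> B" by blast
  have "(\<Sum>k\<in>UNIV. \<bar>(a *\<^sub>R c) $ k\<bar>) \<le> \<bar>a\<bar> * B"
    using mult_left_mono[OF c(2), of "\<bar>a\<bar>"] by (simp add: abs_mult sum_distrib_left)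
  then show ?case
    by (intro exI[of _ "a *\<^sub>R c"]) (simp add: c(1) sum_distrib_left mult.left_commute)
next
  case (add B f C g)
  then obtain b c :: "real^'m" where
    b: "\<And>x. f x = (\<Sum>k\<in>UNIV. monomial x (e k) * b $ k)" "(\<Sum>k\<in>UNIV. \<bar>b $ k\<bar>) \<le> B" and
    c: "\<And>x. g x = (\<Sum>k\<in>UNIV. monomial x (e k) * c $ k)" "(\<Sum>k\<in>UNIV. \<bar>c $ k\<bar>) \<le> C"
    by blast
  have "(\<Sum>k\<in>UNIV. \<bar>(b + c) $ k\<bar>) \<le> (\<Sum>k\<in>UNIV. \<bar>b $ k\<bar> + \<bar>c $ k\<bar>)"
    by (intro sum_mono) simp
  also have "\<dots> \<le> B + C" using b(2) c(2) by (simp add: sum.distrib)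
  finally show ?case
    by (intro exI[of _ "b + c"]) (simp add: b(1) c(1) sum.distrib distrib_left)
qed

section \<open>Separating directions and Lagrange polynomials\<close>

text \<open>Finitely many hyperplanes form a null set and so cannot cover the space.\<close>

lemma ex_not_orthogonal:
  fixes w :: "'i \<Rightarrow> 'a::euclidean_space"
  assumes "finite A" "\<And>i. i \<in> A \<Longrightarrow> w i \<noteq> 0"
  obtains v where "norm v = 1" "\<And>i. i \<in> A \<Longrightarrow> v \<bullet> w i \<noteq> 0"
proof -
  \<comment> \<open>Excluding 0 allows the chosen vector to be normalised even when \<open>A\<close>
    is empty.\<close>
  let ?H = "insert 0 (\<Union>i\<in>A. {x. w i \<bullet> x = 0})"
  have "negligible ?H"
    using assms by (auto intro!: negligible_Union negligible_hyperplane)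
  then obtain x where x: "x \<notin> ?H"
    by (metis UNIV_eq_I non_negligible_UNIV)
  show thesis
    by (rule that[of "x /\<^sub>R norm x"]) (use x in \<open>auto simp: inner_commute\<close>)
qed

context
  fixes z :: "'s::finite \<Rightarrow> real^'n"
  assumes card: "CARD('s) \<ge> 2" and inj: "inj z"
begin

text \<open>Makes \<open>Min_gr_iff\<close> applicable to the inner minimum of
  \<open>rho\<close>.\<close>

lemma others_nonempty: "UNIV - {j::'s} \<noteq> {}"
proof
  assume "UNIV - {j} = {}"
  then have "UNIV = {j}" by blast
  then have "CARD('s) = 1" by (metis card_1_singleton_iff One_nat_def)
  with card show False by simp
qed

text \<open>A direction orthogonal to no difference \<open>z j - z i\<close> makes the inner minimum
  positive. Cauchy-Schwarz bounds these minima over the sphere, as \<open>cSUP_upper\<close>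
  requires.\<close>

lemma rho_pos: "rho z j > 0"
proof -
  let ?m = "\<lambda>v. MIN i\<in>UNIV - {j}. \<bar>v \<bullet> (z j - z i)\<bar>"
  obtain i where i: "i \<in> UNIV - {j}" using others_nonempty by blast
  have "?m v \<le> norm (z j - z i)" if "v \<in> sphere 0 1" for v
  proof -
    have "?m v \<le> \<bar>v \<bullet> (z j - z i)\<bar>" using i by (intro Min_le) auto
    also have "\<dots> \<le> norm v * norm (z j - z i)" by (rule Cauchy_Schwarz_ineq2)
    finally show ?thesis using that by simp
  qed
  then have bdd: "bdd_above (?m ` sphere 0 1)" by (intro bdd_aboveI2)
  obtain v where v: "norm v = 1" "\<And>i. i \<in> UNIV - {j} \<Longrightarrow> v \<bullet> (z j - z i) \<noteq> 0"
    using ex_not_orthogonal[of "UNIV - {j}" "\<lambda>i. z j - z i"] inj by (auto simp: inj_eq)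
  have "0 < ?m v" using others_nonempty v(2) by (subst Min_gr_iff) auto
  also have "\<dots> \<le> rho z j"
    unfolding rho_def using v(1) by (intro cSUP_upper bdd) auto
  finally show ?thesis .
qed

lemma kappa_pos: "kappa z > 0"
  unfolding kappa_def by (subst Min_gr_iff) (auto simp: rho_pos)

text \<open>Halving \<open>kappa z\<close> gives a value strictly below the supremum
  \<open>rho z j\<close>, so some unit vector exceeds it and attainment of the supremum need not be
  shown.\<close>

lemma ex_separating_direction:
  obtains v where "norm v = 1" "\<And>i. i \<noteq> j \<Longrightarrow> \<bar>v \<bullet> (z j - z i)\<bar> > kappa z / 2"
proof -
  let ?m = "\<lambda>v. MIN i\<in>UNIV - {j}. \<bar>v \<bullet> (z j - z i)\<bar>"
  have "kappa z \<le> rho z j" unfolding kappa_def by (intro Min_le) auto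
  then have "kappa z / 2 < (SUP v\<in>sphere 0 1. ?m v)"
    using rho_pos[of j] by (simp add: rho_def)
  moreover have "?m ` sphere 0 1 \<noteq> {}" using vector_choose_size[of 1] by fastforce
  ultimately obtain y where "y \<in> ?m ` sphere 0 1" "kappa z / 2 < y"
    using less_cSupD[of "?m ` sphere 0 1"] by blast
  then obtain v where v: "v \<in> sphere 0 1" "kappa z / 2 < ?m v"
    by blast
  then have "\<forall>i\<in>UNIV - {j}. kappa z / 2 < \<bar>v \<bullet> (z j - z i)\<bar>"
    using others_nonempty[of j] by (subst (asm) Min_gr_iff) auto
  then show thesis
    using v(1) by (intro that[of v]) auto
qed

lemma ex_lagrange_poly:
  assumes ball: "range z \<subseteq> cball 0 1"
  shows "\<exists>f B. poly_l1 (CARD('s) - 1) B f \<and> B \<le> (4 * real CARD('n) / kappa z) ^ (CARD('s) - 1)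
    \<and> (\<forall>i. f (z i) = (if i = j then 1 else 0))"
proof -
  obtain v where v: "norm v = 1" "\<And>i. i \<noteq> j \<Longrightarrow> \<bar>v \<bullet> (z j - z i)\<bar> > kappa z / 2"
    using ex_separating_direction by blast
  let ?A = "UNIV - {j}"
  let ?d = "\<lambda>i. v \<bullet> (z j - z i)"
  \<comment> \<open>\<open>?v i \<bullet> x + ?a i\<close> is the factor
    \<open>(v \<bullet> x - v \<bullet> z i) / ?d i\<close>, in the form that
    \<open>poly_l1_prod_affine\<close> expects.\<close>
  let ?v = "\<lambda>i. v /\<^sub>R ?d i"
  let ?a = "\<lambda>i. - (v \<bullet> z i) / ?d i"
  let ?f = "\<lambda>x. \<Prod>i\<in>?A. ?v i \<bullet> x + ?a i"
  let ?B = "\<Prod>i\<in>?A. (\<Sum>l\<in>UNIV. \<bar>?v i $ l\<bar>) + \<bar>?a i\<bar>"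
  have d: "?d i \<noteq> 0" if "i \<in> ?A" for i
    using v(2)[of i] kappa_pos that by auto
  have "(\<Sum>l\<in>UNIV. \<bar>?v i $ l\<bar>) + \<bar>?a i\<bar> \<le> 4 * real CARD('n) / kappa z" if i: "i \<in> ?A" for i
  proof -
    \<comment> \<open>Each coordinate of a unit vector is at most 1 in absolute value, which gives
      n. The constant term adds at most 1, and n + 1 \<le> 2n.\<close>
    have "(\<Sum>l\<in>UNIV. \<bar>v $ l\<bar>) \<le> real CARD('n)"
      using sum_bounded_above[of UNIV "\<lambda>l. \<bar>v $ l\<bar>" 1] component_le_norm_cart[of v] v(1) by simp
    moreover have "\<bar>v \<bullet> z i\<bar> \<le> 1"
    proof -
      have "norm (z i) \<le> 1" using ball by (simp add: image_subset_iff)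
      then show ?thesis using Cauchy_Schwarz_ineq2[of v "z i"] v(1) by simp
    qed
    moreover have "1 \<le> real CARD('n)" by (simp add: Suc_le_eq)
    ultimately have le: "(\<Sum>l\<in>UNIV. \<bar>v $ l\<bar>) + \<bar>v \<bullet> z i\<bar> \<le> 2 * real CARD('n)"
      by linarith
    have "(\<Sum>l\<in>UNIV. \<bar>?v i $ l\<bar>) + \<bar>?a i\<bar> = ((\<Sum>l\<in>UNIV. \<bar>v $ l\<bar>) + \<bar>v \<bullet> z i\<bar>) / \<bar>?d i\<bar>"
      by (simp add: abs_mult divide_inverse mult.commute sum_distrib_right distrib_left)
    also have "\<dots> \<le> 2 * real CARD('n) / (kappa z / 2)"
      using le v(2)[of i] i kappa_pos by (intro frac_le) auto
    finally show ?thesis by simp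
  qed
  then have "?B \<le> (\<Prod>i\<in>?A. 4 * real CARD('n) / kappa z)"
    by (intro prod_mono) (auto intro: add_nonneg_nonneg sum_nonneg)
  then have "?B \<le> (4 * real CARD('n) / kappa z) ^ (CARD('s) - 1)" by simp
  moreover have "poly_l1 (CARD('s) - 1) ?B ?f"
    using poly_l1_prod_affine[of ?A ?v ?a] by simp
  moreover have "?f (z i) = (if i = j then 1 else 0)" for i
  proof (cases "i = j")
    case True
    have "?v k \<bullet> z j + ?a k = 1" if "k \<in> ?A" for k
    proof -
      have "?v k \<bullet> z j + ?a k = (v \<bullet> z j - v \<bullet> z k) / ?d k"
        by (simp add: divide_inverse mult.commute right_diff_distrib)
      then show ?thesis using d[OF that] by (simp add: inner_diff_right)
    qed
    then show ?thesis using True by simp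
  next
    case False
    \<comment> \<open>The factor belonging to \<open>i\<close> itself vanishes at
      \<open>z i\<close>.\<close>
    then have "\<exists>k\<in>?A. ?v k \<bullet> z i + ?a k = 0"
      by (intro bexI[of _ i]) (simp_all add: divide_inverse mult.commute)
    then have "?f (z i) = 0" by (intro prod_zero) simp_all
    then show ?thesis using False by simp
  qed
  ultimately show ?thesis by blast
qed

end

section \<open>Assembling and bounding the right inverse\<close>

text \<open>\<open>W *v y\<close> is a combination of the columns with weights \<open>y $ j\<close>,
  each at most \<open>norm y\<close> in absolute value; apply the triangle inequality.\<close>

lemma onorm_matrix_le_columns:
  fixes W :: "real^'s^'m"
  assumes "\<And>j. norm (column j W) \<le> C"
  shows "onorm (\<lambda>y. W *v y) \<le> real CARD('s) * C"
proof (rule onorm_le)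
  fix y :: "real^'s"
  have "norm (W *v y) \<le> (\<Sum>j\<in>UNIV. norm (y $ j *s column j W))"
    by (simp add: matrix_mult_sum norm_sum)
  also have "\<dots> \<le> (\<Sum>j\<in>(UNIV::'s set). norm y * C)"
    using assms component_le_norm_cart[of y]
    by (intro sum_mono) (auto simp: scalar_mult_eq_scaleR intro!: mult_mono)
  finally show "norm (W *v y) \<le> real CARD('s) * C * norm y"
    by (simp add: mult.commute mult.left_commute)
qed

theorem theorem2p7:
  fixes z :: "'s::finite \<Rightarrow> real^'n"
    and N :: nat
    and e :: "'m::finite \<Rightarrow> 'n \<Rightarrow> nat"
  assumes "CARD('s) \<ge> 2"
    and "inj z"
    and "range z \<subseteq> cball 0 1"
    and "N \<ge> CARD('s) - 1"
    and "bij_betw e UNIV (multi_indices N)"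
  shows "\<exists>W :: real^'s^'m.
           monomial_matrix e z ** W = mat 1 \<and>
           onorm (\<lambda>y. W *v y) \<le>
             real CARD('s) powr (3/2) * sqrt (real (nu CARD('n) N))
               * (4 * real CARD('n) / kappa z) ^ (CARD('s) - 1)"
proof -
  let ?K = "(4 * real CARD('n) / kappa z) ^ (CARD('s) - 1)"
  have K: "0 \<le> ?K" using kappa_pos[OF assms(1,2)] by simp
  have "\<exists>c::real^'m. (\<forall>i. (\<Sum>k\<in>UNIV. monomial (z i) (e k) * c $ k) = (if i = j then 1 else 0))
      \<and> (\<Sum>k\<in>UNIV. \<bar>c $ k\<bar>) \<le> ?K" for j
  proof -
    obtain f B where f: "poly_l1 (CARD('s) - 1) B f" "B \<le> ?K"
        "\<And>i. f (z i) = (if i = j then 1 else 0)"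
      using ex_lagrange_poly[OF assms(1-3)] by blast
    obtain c :: "real^'m" where c: "\<And>x. f x = (\<Sum>k\<in>UNIV. monomial x (e k) * c $ k)"
        "(\<Sum>k\<in>UNIV. \<bar>c $ k\<bar>) \<le> B"
      \<comment> \<open>The degree s - 1 is raised to \<open>N\<close>, the degree that
        \<open>e\<close> enumerates.\<close>
      using poly_l1_coefficients[OF poly_l1_mono[OF f(1) assms(4)] assms(5)] by blast
    show ?thesis
      using c(2) f(2) by (intro exI[of _ c]) (simp add: f(3) flip: c(1))
  qed
  then have "\<exists>c :: 's \<Rightarrow> real^'m. \<forall>j. (\<forall>i. (\<Sum>k\<in>UNIV. monomial (z i) (e k) * c j $ k)
      = (if i = j then 1 else 0)) \<and> (\<Sum>k\<in>UNIV. \<bar>c j $ k\<bar>) \<le> ?K"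
    by (intro choice allI)
  then obtain c :: "'s \<Rightarrow> real^'m" where
    c: "\<And>i j. (\<Sum>k\<in>UNIV. monomial (z i) (e k) * c j $ k) = (if i = j then 1 else 0)"
      "\<And>j. (\<Sum>k\<in>UNIV. \<bar>c j $ k\<bar>) \<le> ?K"
    by blast
  let ?W = "\<chi> k j. c j $ k"
  \<comment> \<open>Entry (i, j) of the product is the value of the j-th Lagrange polynomial at
    \<open>z i\<close>.\<close>
  have "monomial_matrix e z ** ?W = mat 1"
    by (simp add: vec_eq_iff matrix_matrix_mult_def monomial_matrix_def mat_def c(1))
  moreover have "onorm (\<lambda>y. ?W *v y) \<le> real CARD('s) * ?K"
  proof (rule onorm_matrix_le_columns)
    fix j
    have "column j ?W = c j" by (simp add: column_def vec_eq_iff)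
    then show "norm (column j ?W) \<le> ?K"
      using norm_le_l1_cart[of "c j"] c(2)[of j] by simp
  qed
  \<comment> \<open>The construction gives the bound s \<open>?K\<close>; the stated one follows
    from s \<le> s^(3/2) and \<open>nu\<close> \<ge> 1.\<close>
  moreover have "real CARD('s) * ?K
      \<le> real CARD('s) powr (3/2) * sqrt (real (nu CARD('n) N)) * ?K"
  proof (rule mult_right_mono[OF _ K])
    have "real CARD('s) powr 1 \<le> real CARD('s) powr (3/2)"
      using assms(1) by (intro powr_mono) auto
    moreover have "1 \<le> sqrt (real (nu CARD('n) N))"
      by (simp add: nu_def Suc_le_eq)
    ultimately show "real CARD('s) \<le> real CARD('s) powr (3/2) * sqrt (real (nu CARD('n) N))"
      using mult_mono[of "real CARD('s)" "real CARD('s) powr (3/2)" 1] by simp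
  qed
  ultimately show ?thesis by (meson order_trans)
qed

end
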